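(* Let $(\mathfrak g,\langle\cdot,\cdot\rangle,\Phi)$, $\Phi=(D,\theta)$, be a weak extrinsic symmetric triple and let $R:=\mathfrak g\cap\mathfrak g^\perp=\{X\in\mathfrak g\mid\langle X,Y\rangle=0\text{ for all }Y\in\mathfrak g\}$ be its metric radical. Then: 1. $R$ is contained in the centre of $\mathfrak g$. 2. The quotient $\mathfrak g_0:=\mathfrak g/R$, together with the inner product and the pair of maps induced by $\langle\cdot,\cdot\rangle$ and $\Phi$, is an extrinsic symmetric triple.
   Context: All vector spaces and Lie algebras are real and finite-dimensional. For a Lie algebra $\mathfrak g$ with involution $\theta$, $\mathfrak g_\pm$ are the $\pm1$-eigenspaces of $\theta$. If $D$ is a derivation of $\mathfrak g$ with $D^3=-D$ and $D\theta=-\theta D$, put $\mathfrak g^+=\ker D$, $\mathfrak g^-=\{X\mid D^2X=-X\}$, and $\mathfrak g_+^+=\mathfrak g_+\cap\mathfrak g^+$, $\mathfrak g_+^-=\mathfrak g_+\cap\mathfrak g^-$, $\mathfrak g_-^+=\mathfrak g_-\cap\mathfrak g^+$, $\mathfrak g_-^-=\mathfrak g_-\cap\mathfrak g^-$. An extrinsic symmetric triple $(\mathfrak g,\langle\cdot,\cdot\rangle,\Phi)$ consists of a Lie algebra $\mathfrak g$, a non-degenerate $\operatorname{ad}(\mathfrak g)$-invariant symmetric bilinear form $\langle\cdot,\cdot\rangle$ on $\mathfrak g$ and a pair $\Phi=(D,\theta)$, where $\theta$ is an involutive automorphism of $\mathfrak g$ preserving $\langle\cdot,\cdot\rangle$ and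 $D$ is a derivation, anti-symmetric with respect to $\langle\cdot,\cdot\rangle$, with $D^3=-D$, $D\theta=-\theta D$ and $[\mathfrak g_+^-,\mathfrak g_+^-]=\mathfrak g_+^+$. A weak extrinsic symmetric triple is defined in the same way, except that $\langle\cdot,\cdot\rangle$ is only required to be non-degenerate on $\mathfrak g_+\oplus\mathfrak g_-^-$ (it may be degenerate on $\mathfrak g$). For a weak extrinsic symmetric triple the metric radical $R$ is contained in $\mathfrak g_-^+$ and is an ideal of $\mathfrak g$; $\langle\cdot,\cdot\rangle$, $D$ and $\theta$ descend to $\mathfrak g/R$. *)

theory Defs
  imports "HOL-Algebra.AbelCoset" "Jordan_Normal_Form.VS_Connect" Complex_Main
begin

text \<open>Lie algebras live on an explicit carrier, so that a Lie algebra and its quotients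
  (whose elements are cosets) are instances of the same notion. The fields \<^term>\<open>mult\<close> and
  \<^term>\<open>one\<close>, which the module record inherits from rings, are not used.\<close>

record 'a lie_alg = "(real, 'a) module" +
  lie_bracket :: "'a \<Rightarrow> 'a \<Rightarrow> 'a"

abbreviation real_field :: "real ring" where
  "real_field \<equiv> class_ring"

locale real_lie_algebra = vectorspace real_field L
  for L :: "('a, 'm) lie_alg_scheme" (structure) +
  assumes finite_dimensional: "fin_dim"
    and bracket_closed:
      "\<And>x y. x \<in> carrier L \<Longrightarrow> y \<in> carrier L \<Longrightarrow> lie_bracket L x y \<in> carrier L"
    and bracket_add_left:
      "\<And>x y z. x \<in> carrier L \<Longrightarrow> y \<in> carrier L \<Longrightarrow> z \<in> carrier L \<Longrightarrow>
        lie_bracket L (x \<oplus>\<^bsub>L\<^esub> y) z = lie_bracket L x z \<oplus>\<^bsub>L\<^esub> lie_bracket L y z"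
    and bracket_add_right:
      "\<And>x y z. x \<in> carrier L \<Longrightarrow> y \<in> carrier L \<Longrightarrow> z \<in> carrier L \<Longrightarrow>
        lie_bracket L x (y \<oplus>\<^bsub>L\<^esub> z) = lie_bracket L x y \<oplus>\<^bsub>L\<^esub> lie_bracket L x z"
    and bracket_smult_left:
      "\<And>c x y. x \<in> carrier L \<Longrightarrow> y \<in> carrier L \<Longrightarrow>
        lie_bracket L (c \<odot>\<^bsub>L\<^esub> x) y = c \<odot>\<^bsub>L\<^esub> lie_bracket L x y"
    and bracket_smult_right:
      "\<And>c x y. x \<in> carrier L \<Longrightarrow> y \<in> carrier L \<Longrightarrow>
        lie_bracket L x (c \<odot>\<^bsub>L\<^esub> y) = c \<odot>\<^bsub>L\<^esub> lie_bracket L x y"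
    and bracket_alternating:
      "\<And>x. x \<in> carrier L \<Longrightarrow> lie_bracket L x x = \<zero>\<^bsub>L\<^esub>"
    and jacobi:
      "\<And>x y z. x \<in> carrier L \<Longrightarrow> y \<in> carrier L \<Longrightarrow> z \<in> carrier L \<Longrightarrow>
        lie_bracket L x (lie_bracket L y z) \<oplus>\<^bsub>L\<^esub> lie_bracket L y (lie_bracket L z x)
          \<oplus>\<^bsub>L\<^esub> lie_bracket L z (lie_bracket L x y) = \<zero>\<^bsub>L\<^esub>"

definition lie_center :: "('a, 'm) lie_alg_scheme \<Rightarrow> 'a set" where
  "lie_center L = {x \<in> carrier L. \<forall>y \<in> carrier L. lie_bracket L x y = \<zero>\<^bsub>L\<^esub>}"

definition lie_automorphism :: "('a, 'm) lie_alg_scheme \<Rightarrow> ('a \<Rightarrow> 'a) \<Rightarrow> bool" where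
  "lie_automorphism L f \<longleftrightarrow>
     linear_map real_field L L f \<and> bij_betw f (carrier L) (carrier L) \<and>
     (\<forall>x \<in> carrier L. \<forall>y \<in> carrier L. f (lie_bracket L x y) = lie_bracket L (f x) (f y))"

definition lie_derivation :: "('a, 'm) lie_alg_scheme \<Rightarrow> ('a \<Rightarrow> 'a) \<Rightarrow> bool" where
  "lie_derivation L D \<longleftrightarrow>
     linear_map real_field L L D \<and>
     (\<forall>x \<in> carrier L. \<forall>y \<in> carrier L.
        D (lie_bracket L x y) = lie_bracket L (D x) y \<oplus>\<^bsub>L\<^esub> lie_bracket L x (D y))"

definition symmetric_bilinear_form ::
    "('a, 'm) lie_alg_scheme \<Rightarrow> ('a \<Rightarrow> 'a \<Rightarrow> real) \<Rightarrow> bool" where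
  "symmetric_bilinear_form L B \<longleftrightarrow>
     (\<forall>x \<in> carrier L. \<forall>y \<in> carrier L. B x y = B y x) \<and>
     (\<forall>x \<in> carrier L. \<forall>y \<in> carrier L. \<forall>z \<in> carrier L. B (x \<oplus>\<^bsub>L\<^esub> y) z = B x z + B y z) \<and>
     (\<forall>c. \<forall>x \<in> carrier L. \<forall>y \<in> carrier L. B (c \<odot>\<^bsub>L\<^esub> x) y = c * B x y)"

definition ad_invariant :: "('a, 'm) lie_alg_scheme \<Rightarrow> ('a \<Rightarrow> 'a \<Rightarrow> real) \<Rightarrow> bool" where
  "ad_invariant L B \<longleftrightarrow>
     (\<forall>x \<in> carrier L. \<forall>y \<in> carrier L. \<forall>z \<in> carrier L.
        B (lie_bracket L x y) z = - B y (lie_bracket L x z))"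

text \<open>Non-degeneracy of the restriction of \<^term>\<open>B\<close> to a subspace \<^term>\<open>W\<close>.\<close>

definition nondegenerate_on ::
    "('a, 'm) lie_alg_scheme \<Rightarrow> 'a set \<Rightarrow> ('a \<Rightarrow> 'a \<Rightarrow> real) \<Rightarrow> bool" where
  "nondegenerate_on L W B \<longleftrightarrow> (\<forall>x \<in> W. (\<forall>y \<in> W. B x y = 0) \<longrightarrow> x = \<zero>\<^bsub>L\<^esub>)"

definition metric_radical ::
    "('a, 'm) lie_alg_scheme \<Rightarrow> ('a \<Rightarrow> 'a \<Rightarrow> real) \<Rightarrow> 'a set" where
  "metric_radical L B = {x \<in> carrier L. \<forall>y \<in> carrier L. B x y = 0}"

text \<open>Lower signs (eigenspaces of the involution) are written \<open>lo_\<close>, upper signs (coming from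
  the derivation) are written \<open>up_\<close>. The name \<open>lo_plus_up_minus\<close> thus stands for the
  intersection of the \<open>1\<close>-eigenspace of the involution with the kernel of \<open>D\<^sup>2 + 1\<close>.\<close>

definition lo_plus :: "('a, 'm) lie_alg_scheme \<Rightarrow> ('a \<Rightarrow> 'a) \<Rightarrow> 'a set" where
  "lo_plus L \<theta> = {x \<in> carrier L. \<theta> x = x}"

definition lo_minus :: "('a, 'm) lie_alg_scheme \<Rightarrow> ('a \<Rightarrow> 'a) \<Rightarrow> 'a set" where
  "lo_minus L \<theta> = {x \<in> carrier L. \<theta> x = \<ominus>\<^bsub>L\<^esub> x}"

definition up_plus :: "('a, 'm) lie_alg_scheme \<Rightarrow> ('a \<Rightarrow> 'a) \<Rightarrow> 'a set" where
  "up_plus L D = {x \<in> carrier L. D x = \<zero>\<^bsub>L\<^esub>}"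

definition up_minus :: "('a, 'm) lie_alg_scheme \<Rightarrow> ('a \<Rightarrow> 'a) \<Rightarrow> 'a set" where
  "up_minus L D = {x \<in> carrier L. D (D x) = \<ominus>\<^bsub>L\<^esub> x}"

abbreviation lo_plus_up_plus ::
    "('a, 'm) lie_alg_scheme \<Rightarrow> ('a \<Rightarrow> 'a) \<Rightarrow> ('a \<Rightarrow> 'a) \<Rightarrow> 'a set" where
  "lo_plus_up_plus L D \<theta> \<equiv> lo_plus L \<theta> \<inter> up_plus L D"

abbreviation lo_plus_up_minus ::
    "('a, 'm) lie_alg_scheme \<Rightarrow> ('a \<Rightarrow> 'a) \<Rightarrow> ('a \<Rightarrow> 'a) \<Rightarrow> 'a set" where
  "lo_plus_up_minus L D \<theta> \<equiv> lo_plus L \<theta> \<inter> up_minus L D"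

abbreviation lo_minus_up_minus ::
    "('a, 'm) lie_alg_scheme \<Rightarrow> ('a \<Rightarrow> 'a) \<Rightarrow> ('a \<Rightarrow> 'a) \<Rightarrow> 'a set" where
  "lo_minus_up_minus L D \<theta> \<equiv> lo_minus L \<theta> \<inter> up_minus L D"

text \<open>The conditions common to weak and ordinary triples, i.e. all but non-degeneracy. As usual,
  the bracket of two subspaces is the linear span of the brackets of their elements.\<close>

locale extrinsic_triple_conditions = real_lie_algebra L
  for L :: "('a, 'm) lie_alg_scheme" (structure) +
  fixes B :: "'a \<Rightarrow> 'a \<Rightarrow> real" and D :: "'a \<Rightarrow> 'a" and \<theta> :: "'a \<Rightarrow> 'a"
  assumes form: "symmetric_bilinear_form L B"
    and invariant: "ad_invariant L B"
    and theta_automorphism: "lie_automorphism L \<theta>"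
    and theta_involutive: "\<And>x. x \<in> carrier L \<Longrightarrow> \<theta> (\<theta> x) = x"
    and theta_isometric:
      "\<And>x y. x \<in> carrier L \<Longrightarrow> y \<in> carrier L \<Longrightarrow> B (\<theta> x) (\<theta> y) = B x y"
    and D_derivation: "lie_derivation L D"
    and D_antisymmetric:
      "\<And>x y. x \<in> carrier L \<Longrightarrow> y \<in> carrier L \<Longrightarrow> B (D x) y = - B x (D y)"
    and D_cubed: "\<And>x. x \<in> carrier L \<Longrightarrow> D (D (D x)) = \<ominus>\<^bsub>L\<^esub> D x"
    and D_theta_anticommute: "\<And>x. x \<in> carrier L \<Longrightarrow> D (\<theta> x) = \<ominus>\<^bsub>L\<^esub> \<theta> (D x)"
    and bracket_generates:
      "span {lie_bracket L x y | x y.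
          x \<in> lo_plus_up_minus L D \<theta> \<and> y \<in> lo_plus_up_minus L D \<theta>}
        = lo_plus_up_plus L D \<theta>"

locale extrinsic_symmetric_triple = extrinsic_triple_conditions +
  assumes nondegenerate: "nondegenerate_on L (carrier L) B"

locale weak_extrinsic_symmetric_triple = extrinsic_triple_conditions +
  assumes weakly_nondegenerate:
    "nondegenerate_on L (subspace_sum (lo_plus L \<theta>) (lo_minus_up_minus L D \<theta>)) B"

text \<open>The quotient by an ideal \<^term>\<open>I\<close>, with cosets as elements. As for quotient rings in
  \<open>HOL-Algebra\<close>, operations take the union of the cosets obtained from all representatives;
  this is a single coset exactly when the operation is well-defined.\<close>

definition lie_quotient :: "('a, 'm) lie_alg_scheme \<Rightarrow> 'a set \<Rightarrow> 'a set lie_alg" where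
  "lie_quotient L I =
     \<lparr> carrier = a_rcosets\<^bsub>L\<^esub> I,
       mult = undefined,
       one = undefined,
       zero = I,
       add = set_add L,
       smult = (\<lambda>c P. \<Union>x\<in>P. I +>\<^bsub>L\<^esub> (c \<odot>\<^bsub>L\<^esub> x)),
       lie_bracket = (\<lambda>P Q. \<Union>x\<in>P. \<Union>y\<in>Q. I +>\<^bsub>L\<^esub> (lie_bracket L x y)) \<rparr>"

definition quotient_map ::
    "('a, 'm) lie_alg_scheme \<Rightarrow> 'a set \<Rightarrow> ('a \<Rightarrow> 'a) \<Rightarrow> 'a set \<Rightarrow> 'a set" where
  "quotient_map L I f P = (\<Union>x\<in>P. I +>\<^bsub>L\<^esub> (f x))"

text \<open>The common value of \<^term>\<open>B\<close> on all representatives (unspecified if there is none).\<close>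

definition quotient_form :: "('a \<Rightarrow> 'a \<Rightarrow> real) \<Rightarrow> 'a set \<Rightarrow> 'a set \<Rightarrow> real" where
  "quotient_form B P Q = the_elem {B x y | x y. x \<in> P \<and> y \<in> Q}"

end

theory Submission
  imports Defs
begin

text \<open>Write \<open>R\<close> for the metric radical. Since \<open>\<theta>\<close> is an isometry and \<open>D\<close> and all \<open>ad x\<close> are
  anti-symmetric, \<open>R\<close> is an ideal that is stable under \<open>\<theta>\<close> and \<open>D\<close>. Non-degeneracy on
  \<open>g\<^sub>+ + g\<^sub>-\<^sup>-\<close> enters through one consequence only, \<open>radical_fixed_zero\<close>: a vector of \<open>R\<close>
  fixed by \<open>\<theta>\<close> vanishes. Centrality is obtained by exhibiting elements of \<open>R\<close> that \<open>\<theta>\<close>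
  fixes.

  For \<open>r\<close> in \<open>R\<close> the vector \<open>r + \<theta> r\<close> is such an element, so \<open>\<theta> = -1\<close> on \<open>R\<close>; as \<open>D\<close>
  anticommutes with \<open>\<theta>\<close>, the vector \<open>D r\<close> is another one, so \<open>D = 0\<close> on \<open>R\<close>. If \<open>\<theta> x = -x\<close>, then
  \<open>[r, x]\<close> is a third, so \<open>r\<close> commutes with \<open>g\<^sub>-\<close>. If \<open>x\<close> lies in \<open>g\<^sub>+\<^sup>-\<close>, then \<open>D x\<close> lies in
  \<open>g\<^sub>-\<close>, and applying \<open>D\<close> to \<open>[r, D x] = 0\<close> gives \<open>[r, D (D x)] = -[r, x] = 0\<close>. The centralizer
  of \<open>r\<close> is a subalgebra, hence contains \<open>g\<^sub>+\<^sup>+ = [g\<^sub>+\<^sup>-, g\<^sub>+\<^sup>-]\<close> too. These three subspaces span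
  \<open>g\<close>, so \<open>r\<close> is central (\<open>radical_central\<close>).

  For the quotient, all conditions that are identities between elements pass to cosets, and the
  induced form is non-degenerate because its kernel was divided out. The condition that needs an
  argument is \<open>[g\<^sub>+\<^sup>-, g\<^sub>+\<^sup>-] = g\<^sub>+\<^sup>+\<close>, since an eigenvector of an induced map might have no
  eigenvector among its representatives. Averaging over \<open>\<theta>\<close> lifts \<open>\<theta>\<close>-fixed cosets to
  \<open>\<theta>\<close>-fixed vectors, \<open>x \<mapsto> -D (D x)\<close> corrects a lift to lie in \<open>g\<^sub>+\<^sup>-\<close>, and \<open>D = 0\<close> on \<open>R\<close> shows
  that a \<open>\<theta>\<close>-fixed lift of a coset killed by \<open>D\<close> lies in \<open>g\<^sub>+\<^sup>+\<close>. So both parts of the quotient are images of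
  the corresponding parts of \<open>g\<close>, and the condition follows because spans commute with linear
  maps.\<close>

section \<open>Spans, centralizers and elementary bracket identities\<close>

lemma (in linear_map) span_image:
  assumes S: "S \<subseteq> carrier V"
  shows "W.module.span (T ` S) = T ` V.module.span S"
proof
  have TS: "T ` S \<subseteq> carrier W" using S by auto
  interpret s: submodule K "V.module.span S" V by (rule V.module.span_is_submodule[OF S])
  interpret t: submodule K "W.module.span (T ` S)" W by (rule W.module.span_is_submodule[OF TS])
  have sub: "V.module.span S \<subseteq> carrier V" by (rule s.subset)
  have "submodule K (T ` V.module.span S) W"
  proof
    show "T ` V.module.span S \<subseteq> carrier W" using sub by auto
    show "\<zero>\<^bsub>W\<^esub> \<in> T ` V.module.span S" by (metis T0_is_0 imageI s.zero_closed)
    fix v w assume "v \<in> T ` V.module.span S" "w \<in> T ` V.module.span S"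
    then obtain x y where "v = T x" "w = T y" "x \<in> V.module.span S" "y \<in> V.module.span S" by auto
    moreover from this have "x \<in> carrier V" "y \<in> carrier V" using sub by blast+
    ultimately have "v \<oplus>\<^bsub>W\<^esub> w = T (x \<oplus>\<^bsub>V\<^esub> y)" by (simp add: T_add)
    then show "v \<oplus>\<^bsub>W\<^esub> w \<in> T ` V.module.span S"
      using \<open>x \<in> V.module.span S\<close> \<open>y \<in> V.module.span S\<close> by auto
  next
    fix c v assume "c \<in> carrier K" "v \<in> T ` V.module.span S"
    then obtain x where "v = T x" "x \<in> V.module.span S" by auto
    moreover from this have "x \<in> carrier V" using sub by blast
    ultimately have "c \<odot>\<^bsub>W\<^esub> v = T (c \<odot>\<^bsub>V\<^esub> x)" using \<open>c \<in> carrier K\<close> by (simp add: T_smult)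
    then show "c \<odot>\<^bsub>W\<^esub> v \<in> T ` V.module.span S"
      using \<open>x \<in> V.module.span S\<close> \<open>c \<in> carrier K\<close> by auto
  qed
  moreover have "T ` S \<subseteq> T ` V.module.span S" using V.module.in_own_span[OF S] by auto
  ultimately show "W.module.span (T ` S) \<subseteq> T ` V.module.span S" by (rule W.module.span_is_subset[rotated])
  let ?P = "{v \<in> carrier V. T v \<in> W.module.span (T ` S)}"
  have "submodule K ?P V"
    by unfold_locales (auto simp: T_add T_smult)
  moreover have "S \<subseteq> ?P" using S W.module.in_own_span[OF TS] by auto
  ultimately have "V.module.span S \<subseteq> ?P" by (rule V.module.span_is_subset[rotated])
  then show "T ` V.module.span S \<subseteq> W.module.span (T ` S)" by auto
qed

context real_lie_algebra
begin

lemma real_smult_closed [simp, intro]: "x \<in> carrier L \<Longrightarrow> c \<odot>\<^bsub>L\<^esub> x \<in> carrier L"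
  using smult_closed by simp

lemma minus_swap:
  assumes "x \<in> carrier L" "y \<in> carrier L" "\<ominus>\<^bsub>L\<^esub> x = y" shows "x = \<ominus>\<^bsub>L\<^esub> y"
  unfolding assms(3)[symmetric] using assms(1) by simp

lemma a_inv_zero: "\<ominus>\<^bsub>L\<^esub> \<zero>\<^bsub>L\<^esub> = \<zero>\<^bsub>L\<^esub>"
  using minus_equality[of "\<zero>\<^bsub>L\<^esub>" "\<zero>\<^bsub>L\<^esub>"] by simp

lemma a_inv_eq_smult: "x \<in> carrier L \<Longrightarrow> \<ominus>\<^bsub>L\<^esub> x = (- 1) \<odot>\<^bsub>L\<^esub> x"
  using smult_minus_1[of x] by (simp add: class_ring_simps)

lemma half_double: "x \<in> carrier L \<Longrightarrow> (1 / 2) \<odot>\<^bsub>L\<^esub> (x \<oplus>\<^bsub>L\<^esub> x) = x"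
  using smult_l_distr[of "1/2" "1/2" x] smult_one[of x] by (simp add: smult_r_distr)

lemma bracket_minus_left: "x \<in> carrier L \<Longrightarrow> y \<in> carrier L \<Longrightarrow>
    lie_bracket L (\<ominus>\<^bsub>L\<^esub> x) y = \<ominus>\<^bsub>L\<^esub> lie_bracket L x y"
  by (simp add: a_inv_eq_smult bracket_smult_left bracket_closed)

lemma bracket_minus_right: "x \<in> carrier L \<Longrightarrow> y \<in> carrier L \<Longrightarrow>
    lie_bracket L x (\<ominus>\<^bsub>L\<^esub> y) = \<ominus>\<^bsub>L\<^esub> lie_bracket L x y"
  by (simp add: a_inv_eq_smult bracket_smult_right bracket_closed)

lemma bracket_antisym:
  assumes "x \<in> carrier L" "y \<in> carrier L"
  shows "lie_bracket L x y = \<ominus>\<^bsub>L\<^esub> lie_bracket L y x"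
proof -
  have "\<zero>\<^bsub>L\<^esub> = lie_bracket L (x \<oplus>\<^bsub>L\<^esub> y) (x \<oplus>\<^bsub>L\<^esub> y)"
    using assms by (simp add: bracket_alternating)
  also have "\<dots> = lie_bracket L x (x \<oplus>\<^bsub>L\<^esub> y) \<oplus>\<^bsub>L\<^esub> lie_bracket L y (x \<oplus>\<^bsub>L\<^esub> y)"
    using assms by (intro bracket_add_left) auto
  also have "\<dots> = lie_bracket L x y \<oplus>\<^bsub>L\<^esub> lie_bracket L y x"
    using assms by (simp add: bracket_add_right bracket_alternating bracket_closed)
  finally show ?thesis
    using assms minus_equality[of "lie_bracket L x y" "lie_bracket L y x"] by (simp add: bracket_closed)
qed

lemma bracket_zero_right: "x \<in> carrier L \<Longrightarrow> lie_bracket L x \<zero>\<^bsub>L\<^esub> = \<zero>\<^bsub>L\<^esub>"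
  using bracket_smult_right[of x "\<zero>\<^bsub>L\<^esub>" 0] smult_l_null[of "lie_bracket L x \<zero>\<^bsub>L\<^esub>"]
  by (simp add: bracket_closed)

lemma linear_endomorphismI:
  assumes "\<And>x. x \<in> carrier L \<Longrightarrow> f x \<in> carrier L"
    and "\<And>x y. x \<in> carrier L \<Longrightarrow> y \<in> carrier L \<Longrightarrow> f (x \<oplus>\<^bsub>L\<^esub> y) = f x \<oplus>\<^bsub>L\<^esub> f y"
    and "\<And>c x. x \<in> carrier L \<Longrightarrow> f (c \<odot>\<^bsub>L\<^esub> x) = c \<odot>\<^bsub>L\<^esub> f x"
  shows "linear_map real_field L L f"
  using assms
  by (intro linear_map.intro mod_hom.intro mod_hom_axioms.intro vectorspace_axioms module_axioms)
     (auto simp: LinearCombinations.module_hom_def)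

definition centralizer where "centralizer r = {x \<in> carrier L. lie_bracket L r x = \<zero>\<^bsub>L\<^esub>}"

text \<open>Together with closure under brackets below, which is the Jacobi identity, this allows
  \<open>[g\<^sub>+\<^sup>-, g\<^sub>+\<^sup>-] = g\<^sub>+\<^sup>+\<close> to be used for proving that an element commutes with \<open>g\<^sub>+\<^sup>+\<close>.\<close>

lemma centralizer_submodule:
  assumes "r \<in> carrier L"
  shows "submodule real_field (centralizer r) L"
proof
  show "\<zero>\<^bsub>L\<^esub> \<in> centralizer r" using assms by (simp add: centralizer_def bracket_zero_right)
qed (use assms in \<open>auto simp: centralizer_def bracket_add_right bracket_smult_right\<close>)

lemma centralizer_bracket:
  assumes r: "r \<in> carrier L" and x: "x \<in> centralizer r" and y: "y \<in> centralizer r"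
  shows "lie_bracket L x y \<in> centralizer r"
proof -
  have [simp]: "x \<in> carrier L" "y \<in> carrier L" "lie_bracket L r x = \<zero>\<^bsub>L\<^esub>" "lie_bracket L r y = \<zero>\<^bsub>L\<^esub>"
    using x y by (auto simp: centralizer_def)
  have "lie_bracket L y r = \<zero>\<^bsub>L\<^esub>" using bracket_antisym[of y r] r by simp
  then show ?thesis
    using jacobi[of r x y] r by (simp add: centralizer_def bracket_closed bracket_zero_right)
qed

end

section \<open>The quotient of a Lie algebra by an ideal\<close>

locale lie_ideal = real_lie_algebra L for L :: "('a, 'm) lie_alg_scheme" (structure) +
  fixes I :: "'a set"
  assumes ideal_submodule: "submodule real_field I L"
    and ideal_bracket: "\<And>x r. x \<in> carrier L \<Longrightarrow> r \<in> I \<Longrightarrow> lie_bracket L x r \<in> I"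
begin

abbreviation proj where "proj x \<equiv> I +> x"
abbreviation Q where "Q \<equiv> lie_quotient L I"

lemma ideal_subset: "I \<subseteq> carrier L"
  using ideal_submodule by (rule submodule.subset)

lemma ideal_minus: "r \<in> I \<Longrightarrow> \<ominus> r \<in> I"
  using submodule.smult_closed[OF ideal_submodule, of "-1" r] ideal_subset
  by (auto simp: a_inv_eq_smult)

lemma ideal_bracket_left: "r \<in> I \<Longrightarrow> x \<in> carrier L \<Longrightarrow> lie_bracket L r x \<in> I"
  using bracket_antisym[of r x] ideal_bracket[of x r] ideal_minus ideal_subset by auto

lemma ideal_subgroup: "subgroup I (add_monoid L)"
  using ideal_subset ideal_minus submodule.m_closed[OF ideal_submodule]
    submodule.zero_closed[OF ideal_submodule]
  by (intro add.subgroupI) (auto simp: a_inv_def[symmetric])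

lemma ideal_abelian_subgroup: "abelian_subgroup I L"
  by (intro abelian_subgroupI3 additive_subgroupI ideal_subgroup abelian_group_axioms)

lemmas proj_add = abelian_subgroup.a_rcos_sum[OF ideal_abelian_subgroup]

lemma mem_proj: "x' \<in> proj x \<longleftrightarrow> (\<exists>r\<in>I. x' = r \<oplus> x)"
  by (auto simp: a_r_coset_def')

lemma proj_self: "x \<in> carrier L \<Longrightarrow> x \<in> proj x"
  by (rule abelian_subgroup.a_rcos_self[OF ideal_abelian_subgroup])

lemma proj_absorb: "r \<in> I \<Longrightarrow> x \<in> carrier L \<Longrightarrow> proj (r \<oplus> x) = proj x"
  using a_repr_independence[OF _ _ ideal_subgroup, of "r \<oplus> x" x] by (auto simp: mem_proj)

lemma proj_ideal: "r \<in> I \<Longrightarrow> proj r = I"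
  by (rule a_coset_join2[OF _ ideal_subgroup]) (use ideal_subset in auto)

lemma proj_eq_iff:
  assumes "x \<in> carrier L" "y \<in> carrier L"
  shows "proj x = proj y \<longleftrightarrow> x \<ominus> y \<in> I"
proof
  assume "proj x = proj y"
  then obtain r where r: "r \<in> I" "x = r \<oplus> y" using proj_self[of x] assms by (auto simp: mem_proj)
  then have "x \<ominus> y = r" using assms ideal_subset by (auto simp: a_minus_def a_assoc r_neg)
  with r show "x \<ominus> y \<in> I" by simp
next
  assume "x \<ominus> y \<in> I"
  moreover have "(x \<ominus> y) \<oplus> y = x" using assms by (simp add: a_minus_def a_assoc l_neg)
  ultimately show "proj x = proj y" using proj_absorb[of "x \<ominus> y" y] assms by simp
qed

lemma carrier_quotient: "carrier Q = proj ` carrier L"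
  by (auto simp: lie_quotient_def A_RCOSETS_def')

lemma zero_quotient: "\<zero>\<^bsub>Q\<^esub> = I"
  by (simp add: lie_quotient_def)

lemma proj_zero: "proj \<zero> = \<zero>\<^bsub>Q\<^esub>"
  by (simp add: zero_quotient ideal_subset)

lemma add_quotient: "x \<in> carrier L \<Longrightarrow> y \<in> carrier L \<Longrightarrow> proj x \<oplus>\<^bsub>Q\<^esub> proj y = proj (x \<oplus> y)"
  by (simp add: lie_quotient_def proj_add)

text \<open>The operations on cosets are unions over representatives; such a union is the common value
  of its terms, the union being over a nonempty set.\<close>

lemma UN_proj:
  assumes "x \<in> carrier L" "\<And>x'. x' \<in> proj x \<Longrightarrow> F x' = C"
  shows "(\<Union>x'\<in>proj x. F x') = C"
  using assms proj_self[of x] by auto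

lemma quotient_map_proj:
  assumes f: "linear_map real_field L L f" and fI: "f ` I \<subseteq> I" and x: "x \<in> carrier L"
  shows "quotient_map L I f (proj x) = proj (f x)"
  unfolding quotient_map_def
proof (rule UN_proj[OF x])
  interpret f: linear_map real_field L L f by (rule f)
  fix x' assume "x' \<in> proj x"
  then obtain r where r: "r \<in> I" "x' = r \<oplus> x" by (auto simp: mem_proj)
  then have "f x' = f r \<oplus> f x" using x ideal_subset by (auto simp: f.T_add)
  then show "proj (f x') = proj (f x)" using r fI x proj_absorb[of "f r" "f x"] by auto
qed

text \<open>Multiplication by \<open>c\<close> is itself a linear endomorphism that preserves \<open>I\<close>, and its induced
  map is the scalar multiplication of the quotient.\<close>

lemma smult_quotient:
  assumes x: "x \<in> carrier L" shows "c \<odot>\<^bsub>Q\<^esub> proj x = proj (c \<odot> x)"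
proof -
  have "linear_map real_field L L ((\<odot>) c)"
  proof (rule linear_endomorphismI)
    fix d x assume "x \<in> carrier L"
    then show "c \<odot> (d \<odot> x) = d \<odot> (c \<odot> x)"
      using smult_assoc1[of c d x] smult_assoc1[of d c x] by (simp add: mult.commute)
  qed (auto simp: smult_r_distr)
  moreover have "(\<odot>) c ` I \<subseteq> I" using submodule.smult_closed[OF ideal_submodule] by auto
  ultimately show ?thesis
    using quotient_map_proj[of "(\<odot>) c" x] x by (simp add: quotient_map_def lie_quotient_def)
qed

lemma bracket_quotient:
  assumes x: "x \<in> carrier L" and y: "y \<in> carrier L"
  shows "lie_bracket Q (proj x) (proj y) = proj (lie_bracket L x y)"
proof -
  have "proj (lie_bracket L x' y') = proj (lie_bracket L x y)"
    if xy': "x' \<in> proj x" "y' \<in> proj y" for x' y'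
  proof -
    obtain r s where rs: "r \<in> I" "x' = r \<oplus> x" "s \<in> I" "y' = s \<oplus> y"
      using xy' by (auto simp: mem_proj)
    then have c: "r \<in> carrier L" "s \<in> carrier L" "y' \<in> carrier L" using ideal_subset y by auto
    \<comment> \<open>The two representatives are changed one at a time: the errors are \<open>[r, y']\<close> and
        \<open>[x, s]\<close>, both in \<open>I\<close>.\<close>
    have "proj (lie_bracket L x' y') = proj (lie_bracket L x y')"
      using rs c x by (simp only: bracket_add_left) (simp add: proj_absorb ideal_bracket_left bracket_closed)
    also have "\<dots> = proj (lie_bracket L x y)"
      using rs c x y by (simp only: bracket_add_right) (simp add: proj_absorb ideal_bracket bracket_closed)
    finally show ?thesis .
  qed
  then have "(\<Union>x'\<in>proj x. \<Union>y'\<in>proj y. proj (lie_bracket L x' y')) = proj (lie_bracket L x y)"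
    by (intro UN_proj[OF x] UN_proj[OF y])
  then show ?thesis by (simp add: lie_quotient_def)
qed

lemma quotient_vectorspace: "vectorspace real_field Q"
proof (rule vs_criteria)
  show "field real_field" by (rule class_field)
  show "\<forall>v\<in>carrier Q. \<exists>w\<in>carrier Q. v \<oplus>\<^bsub>Q\<^esub> w = \<zero>\<^bsub>Q\<^esub>"
  proof
    fix v assume "v \<in> carrier Q"
    then obtain x where "x \<in> carrier L" "v = proj x" by (auto simp: carrier_quotient)
    then show "\<exists>w\<in>carrier Q. v \<oplus>\<^bsub>Q\<^esub> w = \<zero>\<^bsub>Q\<^esub>"
      by (intro bexI[of _ "proj (\<ominus> x)"]) (auto simp: add_quotient carrier_quotient r_neg proj_zero)
  qed
  show "\<zero>\<^bsub>Q\<^esub> \<in> carrier Q" unfolding proj_zero[symmetric] carrier_quotient by blast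
  show "\<forall>v\<in>carrier Q. v \<oplus>\<^bsub>Q\<^esub> \<zero>\<^bsub>Q\<^esub> = v"
    by (auto simp: carrier_quotient add_quotient proj_zero[symmetric])
  show "\<forall>v w. v \<in> carrier Q \<and> w \<in> carrier Q \<longrightarrow> v \<oplus>\<^bsub>Q\<^esub> w \<in> carrier Q"
    by (auto simp: carrier_quotient add_quotient)
  show "\<forall>v w. v \<in> carrier Q \<and> w \<in> carrier Q \<longrightarrow> v \<oplus>\<^bsub>Q\<^esub> w = w \<oplus>\<^bsub>Q\<^esub> v"
    by (auto simp: carrier_quotient add_quotient a_comm)
  show "\<forall>v w x. v \<in> carrier Q \<and> w \<in> carrier Q \<and> x \<in> carrier Q \<longrightarrow>
      (v \<oplus>\<^bsub>Q\<^esub> w) \<oplus>\<^bsub>Q\<^esub> x = v \<oplus>\<^bsub>Q\<^esub> (w \<oplus>\<^bsub>Q\<^esub> x)"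
    by (auto simp: carrier_quotient add_quotient a_assoc)
qed (use smult_l_distr smult_r_distr smult_assoc1 smult_one in
      \<open>auto simp: carrier_quotient add_quotient smult_quotient\<close>)

lemma proj_linear: "linear_map real_field L Q proj"
proof -
  interpret Q: vectorspace real_field Q by (rule quotient_vectorspace)
  show ?thesis
    by (intro linear_map.intro mod_hom.intro mod_hom_axioms.intro vectorspace_axioms module_axioms
        Q.vectorspace_axioms Q.module_axioms)
       (auto simp: LinearCombinations.module_hom_def carrier_quotient add_quotient smult_quotient)
qed

lemma proj_minus: "x \<in> carrier L \<Longrightarrow> \<ominus>\<^bsub>Q\<^esub> proj x = proj (\<ominus> x)"
proof -
  interpret p: linear_map real_field L Q proj by (rule proj_linear)
  show "x \<in> carrier L \<Longrightarrow> \<ominus>\<^bsub>Q\<^esub> proj x = proj (\<ominus> x)" by (simp add: p.T_neg)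
qed

lemma quotient_lie_algebra: "real_lie_algebra Q"
proof (intro real_lie_algebra.intro real_lie_algebra_axioms.intro)
  show "vectorspace.fin_dim real_field Q"
    by (rule linear_map.rank_nullity_main(2)[OF proj_linear finite_dimensional carrier_quotient[symmetric]])
next
  fix v assume "v \<in> carrier Q"
  then obtain x where "x \<in> carrier L" "v = proj x" by (auto simp: carrier_quotient)
  then show "lie_bracket Q v v = \<zero>\<^bsub>Q\<^esub>"
    by (simp add: bracket_quotient bracket_alternating proj_zero)
next
  fix u v w assume "u \<in> carrier Q" "v \<in> carrier Q" "w \<in> carrier Q"
  then obtain x y z where "x \<in> carrier L" "u = proj x" "y \<in> carrier L" "v = proj y"
      "z \<in> carrier L" "w = proj z"
    by (auto simp: carrier_quotient)
  then show "lie_bracket Q u (lie_bracket Q v w) \<oplus>\<^bsub>Q\<^esub> lie_bracket Q v (lie_bracket Q w u)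
      \<oplus>\<^bsub>Q\<^esub> lie_bracket Q w (lie_bracket Q u v) = \<zero>\<^bsub>Q\<^esub>"
    by (simp add: bracket_quotient add_quotient bracket_closed jacobi proj_zero)
qed (auto simp: carrier_quotient add_quotient smult_quotient bracket_quotient bracket_closed
    quotient_vectorspace bracket_add_left bracket_add_right bracket_smult_left
    bracket_smult_right)

lemma quotient_map_linear:
  assumes f: "linear_map real_field L L f" and fI: "f ` I \<subseteq> I"
  shows "linear_map real_field Q Q (quotient_map L I f)"
proof -
  interpret f: linear_map real_field L L f by (rule f)
  interpret Q: real_lie_algebra Q by (rule quotient_lie_algebra)
  show ?thesis
    by (rule Q.linear_endomorphismI)
      (auto simp: carrier_quotient quotient_map_proj[OF f fI] add_quotient smult_quotient
        f.T_add f.T_smult)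
qed

lemma quotient_map_derivation:
  assumes f: "lie_derivation L f" and fI: "f ` I \<subseteq> I"
  shows "lie_derivation Q (quotient_map L I f)"
proof -
  have lin: "linear_map real_field L L f" using f by (simp add: lie_derivation_def)
  interpret f: linear_map real_field L L f by (rule lin)
  show ?thesis using f quotient_map_linear[OF lin fI]
    by (auto simp: lie_derivation_def carrier_quotient quotient_map_proj[OF lin fI] add_quotient
        bracket_quotient bracket_closed)
qed

text \<open>Injectivity of the induced map is the reason for asking \<open>f ` I = I\<close> rather than an inclusion:
  as \<open>f\<close> is injective, it ensures that \<open>f x \<ominus> f y \<in> I\<close> only if \<open>x \<ominus> y \<in> I\<close>.\<close>

lemma quotient_map_automorphism:
  assumes f: "lie_automorphism L f" and fI: "f ` I = I"
  shows "lie_automorphism Q (quotient_map L I f)"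
proof -
  have lin: "linear_map real_field L L f" and bij: "bij_betw f (carrier L) (carrier L)"
    using f by (simp_all add: lie_automorphism_def)
  interpret f: linear_map real_field L L f by (rule lin)
  have fI': "f ` I \<subseteq> I" using fI by simp
  note qm = quotient_map_proj[OF lin fI']
  have "inj_on (quotient_map L I f) (carrier Q)"
  proof (rule inj_onI)
    fix u v assume "u \<in> carrier Q" "v \<in> carrier Q" and eq: "quotient_map L I f u = quotient_map L I f v"
    then obtain x y where xy: "x \<in> carrier L" "u = proj x" "y \<in> carrier L" "v = proj y"
      by (auto simp: carrier_quotient)
    then have "f x \<ominus> f y \<in> I" using eq by (simp add: qm proj_eq_iff)
    then have "f (x \<ominus> y) \<in> f ` I" unfolding fI using xy by simp
    then obtain r where r: "r \<in> I" "f (x \<ominus> y) = f r" by auto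
    have "x \<ominus> y = r"
      by (rule inj_onD[of f "carrier L"]) (use bij xy r ideal_subset in \<open>auto simp: bij_betw_def\<close>)
    then show "u = v" using r xy by (simp add: proj_eq_iff)
  qed
  moreover have "quotient_map L I f ` carrier Q = carrier Q"
  proof -
    have "quotient_map L I f ` carrier Q = proj ` (f ` carrier L)"
      unfolding carrier_quotient image_image by (rule image_cong[OF refl]) (rule qm)
    also have "f ` carrier L = carrier L" using bij by (simp add: bij_betw_def)
    finally show ?thesis by (simp add: carrier_quotient)
  qed
  moreover have "quotient_map L I f (lie_bracket Q u v)
      = lie_bracket Q (quotient_map L I f u) (quotient_map L I f v)"
    if uv: "u \<in> carrier Q" "v \<in> carrier Q" for u v
  proof -
    obtain x y where "x \<in> carrier L" "u = proj x" "y \<in> carrier L" "v = proj y"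
      using uv by (auto simp: carrier_quotient)
    then show ?thesis using f by (simp add: lie_automorphism_def qm bracket_quotient bracket_closed)
  qed
  ultimately show ?thesis
    using quotient_map_linear[OF lin fI'] by (simp add: lie_automorphism_def bij_betw_def)
qed

end

section \<open>The metric radical as an invariant ideal\<close>

context extrinsic_triple_conditions
begin

abbreviation rad where "rad \<equiv> metric_radical L B"

lemma B_sym: "x \<in> carrier L \<Longrightarrow> y \<in> carrier L \<Longrightarrow> B x y = B y x"
  and B_add_left: "x \<in> carrier L \<Longrightarrow> y \<in> carrier L \<Longrightarrow> z \<in> carrier L \<Longrightarrow>
    B (x \<oplus> y) z = B x z + B y z"
  and B_smult_left: "x \<in> carrier L \<Longrightarrow> y \<in> carrier L \<Longrightarrow> B (c \<odot> x) y = c * B x y"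
  using form by (auto simp: symmetric_bilinear_form_def)

lemma B_add_right: "x \<in> carrier L \<Longrightarrow> y \<in> carrier L \<Longrightarrow> z \<in> carrier L \<Longrightarrow>
    B x (y \<oplus> z) = B x y + B x z"
  using B_sym[of x "y \<oplus> z"] B_sym[of x y] B_sym[of x z] B_add_left[of y z x] by simp

lemma B_zero_left: "x \<in> carrier L \<Longrightarrow> B \<zero> x = 0"
  using B_add_left[of \<zero> \<zero> x] by simp

lemma B_bracket: "x \<in> carrier L \<Longrightarrow> y \<in> carrier L \<Longrightarrow> z \<in> carrier L \<Longrightarrow>
    B (lie_bracket L x y) z = - B y (lie_bracket L x z)"
  using invariant by (simp add: ad_invariant_def)

lemma theta_linear: "linear_map real_field L L \<theta>"
  and theta_bracket: "x \<in> carrier L \<Longrightarrow> y \<in> carrier L \<Longrightarrow>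
    \<theta> (lie_bracket L x y) = lie_bracket L (\<theta> x) (\<theta> y)"
  using theta_automorphism by (auto simp: lie_automorphism_def)

lemma D_linear: "linear_map real_field L L D"
  and D_bracket: "x \<in> carrier L \<Longrightarrow> y \<in> carrier L \<Longrightarrow>
    D (lie_bracket L x y) = lie_bracket L (D x) y \<oplus> lie_bracket L x (D y)"
  using D_derivation by (auto simp: lie_derivation_def)

sublocale theta: linear_map real_field L L \<theta> by (rule theta_linear)
sublocale D: linear_map real_field L L D by (rule D_linear)

lemma theta_D: "x \<in> carrier L \<Longrightarrow> \<theta> (D x) = \<ominus> D (\<theta> x)"
  using D_theta_anticommute[of x] by (intro minus_swap) auto

lemma radD: "r \<in> rad \<Longrightarrow> r \<in> carrier L" "r \<in> rad \<Longrightarrow> y \<in> carrier L \<Longrightarrow> B r y = 0"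
  by (auto simp: metric_radical_def)

lemma radical_submodule: "submodule real_field rad L"
proof
  show "\<zero> \<in> rad" by (simp add: metric_radical_def B_zero_left)
qed (auto simp: metric_radical_def B_add_left B_smult_left)

lemma theta_radical:
  assumes "r \<in> rad"
  shows "\<theta> r \<in> rad"
proof -
  have "B (\<theta> r) y = 0" if "y \<in> carrier L" for y
    using theta_isometric[of r "\<theta> y"] that assms by (simp add: theta_involutive radD)
  then show ?thesis using assms by (simp add: metric_radical_def)
qed

lemma D_radical: "r \<in> rad \<Longrightarrow> D r \<in> rad"
  by (auto simp: metric_radical_def D_antisymmetric)

lemma bracket_radical: "x \<in> carrier L \<Longrightarrow> r \<in> rad \<Longrightarrow> lie_bracket L x r \<in> rad"
  by (auto simp: metric_radical_def B_bracket bracket_closed)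

text \<open>As \<open>D\<^sup>3 = -D\<close>, the map \<open>-D\<^sup>2\<close> is the projection onto \<open>g\<^sup>-\<close> along \<open>g\<^sup>+\<close>. It commutes with
  \<open>\<theta>\<close>, since \<open>D\<close> anticommutes, so it restricts to \<open>g\<^sub>+\<close>.\<close>

lemma up_decomposition:
  assumes "x \<in> lo_plus L \<theta>"
  obtains y z where "y \<in> lo_plus_up_plus L D \<theta>" "z \<in> lo_plus_up_minus L D \<theta>" "x = y \<oplus> z"
proof
  have x: "x \<in> carrier L" "\<theta> x = x" using assms by (auto simp: lo_plus_def)
  have th: "\<theta> (D (D x)) = D (D x)" using x by (simp add: theta_D)
  show "x \<oplus> D (D x) \<in> lo_plus_up_plus L D \<theta>"
    using x th by (simp add: lo_plus_def up_plus_def D_cubed r_neg)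
  show "\<ominus> D (D x) \<in> lo_plus_up_minus L D \<theta>"
    using x th by (simp add: lo_plus_def up_minus_def D_cubed)
  show "x = (x \<oplus> D (D x)) \<oplus> \<ominus> D (D x)" using x by (simp add: a_assoc r_neg)
qed

end

sublocale extrinsic_triple_conditions \<subseteq> radical: lie_ideal L "metric_radical L B"
  by (intro lie_ideal.intro lie_ideal_axioms.intro real_lie_algebra_axioms radical_submodule bracket_radical)

section \<open>The radical of a weak triple is central\<close>

context weak_extrinsic_symmetric_triple
begin

text \<open>Such an \<open>r\<close> lies in \<open>g\<^sub>+\<close> and is orthogonal to everything, in particular to
  \<open>g\<^sub>+ + g\<^sub>-\<^sup>-\<close>.\<close>

lemma radical_fixed_zero:
  assumes r: "r \<in> rad" and fixed: "\<theta> r = r"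
  shows "r = \<zero>"
proof -
  let ?W = "subspace_sum (lo_plus L \<theta>) (lo_minus_up_minus L D \<theta>)"
  have "\<zero> \<in> lo_minus_up_minus L D \<theta>" by (simp add: lo_minus_def up_minus_def a_inv_zero)
  moreover have "r \<in> lo_plus L \<theta>" "r \<oplus> \<zero> = r" using r fixed by (auto simp: lo_plus_def radD)
  ultimately have "r \<in> ?W" unfolding submodule_sum_def by force
  moreover have "?W \<subseteq> carrier L" by (auto simp: submodule_sum_def lo_plus_def lo_minus_def)
  then have "\<forall>y\<in>?W. B r y = 0" using r by (auto simp: radD)
  ultimately show ?thesis using weakly_nondegenerate unfolding nondegenerate_on_def by blast
qed

lemma theta_on_radical:
  assumes r: "r \<in> rad" shows "\<theta> r = \<ominus> r"
proof -
  have c: "r \<in> carrier L" using r by (rule radD)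
  have "\<theta> r \<oplus> r \<in> rad"
    using r theta_radical submodule.m_closed[OF radical_submodule] by blast
  moreover have "\<theta> (\<theta> r \<oplus> r) = \<theta> r \<oplus> r" using c by (simp add: theta_involutive a_comm)
  ultimately have "\<theta> r \<oplus> r = \<zero>" by (rule radical_fixed_zero)
  then show ?thesis using c by (simp add: minus_equality)
qed

lemma D_on_radical:
  assumes r: "r \<in> rad" shows "D r = \<zero>"
proof (rule radical_fixed_zero)
  have c: "r \<in> carrier L" using r by (rule radD)
  show "D r \<in> rad" using r by (rule D_radical)
  show "\<theta> (D r) = D r" using c by (simp add: theta_D theta_on_radical[OF r])
qed

lemma radical_bracket_lo_minus:
  assumes r: "r \<in> rad" and x: "x \<in> carrier L" "\<theta> x = \<ominus> x"
  shows "lie_bracket L r x = \<zero>"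
proof (rule radical_fixed_zero)
  have c: "r \<in> carrier L" using r by (rule radD)
  show "lie_bracket L r x \<in> rad" using r x by (intro radical.ideal_bracket_left)
  show "\<theta> (lie_bracket L r x) = lie_bracket L r x"
    using c x by (simp add: theta_bracket theta_on_radical[OF r] bracket_minus_left bracket_minus_right bracket_closed)
qed

text \<open>On \<open>g\<^sub>+\<^sup>-\<close> the derivation \<open>D\<close> maps into \<open>g\<^sub>-\<close>, where \<open>r\<close> is known to commute. Differentiating
  \<open>[r, D x] = 0\<close> leads back to \<open>[r, x]\<close>, because \<open>D r = 0\<close> and \<open>D (D x) = -x\<close>.\<close>

lemma radical_bracket_lo_plus_up_minus:
  assumes r: "r \<in> rad" and x: "x \<in> lo_plus_up_minus L D \<theta>"
  shows "lie_bracket L r x = \<zero>"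
proof -
  have c: "r \<in> carrier L" using r by (rule radD)
  have x': "x \<in> carrier L" "\<theta> x = x" "D (D x) = \<ominus> x" using x by (auto simp: lo_plus_def up_minus_def)
  have "\<theta> (D x) = \<ominus> D x" using x' by (simp add: theta_D)
  then have "lie_bracket L r (D x) = \<zero>" using x' by (intro radical_bracket_lo_minus[OF r]) auto
  then have "\<zero> = D (lie_bracket L r (D x))" by (simp only: D.T0_is_0)
  also have "\<dots> = lie_bracket L \<zero> (D x) \<oplus> lie_bracket L r (\<ominus> x)"
    using x' c by (simp add: D_bracket D_on_radical[OF r])
  also have "\<dots> = \<ominus> lie_bracket L r x"
    using x' c bracket_antisym[of \<zero> "D x"] by (simp add: bracket_minus_right bracket_zero_right bracket_closed)
  finally have "\<ominus> lie_bracket L r x = \<zero>" by (rule sym)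
  then show ?thesis
    using x' c minus_swap[of "lie_bracket L r x" \<zero>] by (simp add: bracket_closed a_inv_zero)
qed

lemma radical_central: "rad \<subseteq> lie_center L"
proof
  fix r assume r: "r \<in> rad"
  then have c: "r \<in> carrier L" by (rule radD)
  interpret C: submodule real_field "centralizer r" L by (rule centralizer_submodule[OF c])
  have pm: "lo_plus_up_minus L D \<theta> \<subseteq> centralizer r"
    using radical_bracket_lo_plus_up_minus[OF r] by (auto simp: centralizer_def lo_plus_def)
  have "{lie_bracket L x y | x y. x \<in> lo_plus_up_minus L D \<theta> \<and> y \<in> lo_plus_up_minus L D \<theta>}
      \<subseteq> centralizer r"
    using pm centralizer_bracket[OF c] by blast
  then have pp: "lo_plus_up_plus L D \<theta> \<subseteq> centralizer r"
    unfolding bracket_generates[symmetric] by (rule span_is_subset[OF _ centralizer_submodule[OF c]])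
  have p: "lo_plus L \<theta> \<subseteq> centralizer r"
  proof
    fix x assume "x \<in> lo_plus L \<theta>"
    then obtain y z where "y \<in> lo_plus_up_plus L D \<theta>" "z \<in> lo_plus_up_minus L D \<theta>" "x = y \<oplus> z"
      by (rule up_decomposition)
    then show "x \<in> centralizer r" using pm pp by blast
  qed
  have m: "lo_minus L \<theta> \<subseteq> centralizer r"
    using radical_bracket_lo_minus[OF r] by (auto simp: centralizer_def lo_minus_def)
  \<comment> \<open>\<open>2x = (x + \<theta> x) + (x - \<theta> x)\<close> splits \<open>x\<close> along \<open>g\<^sub>+\<close> and \<open>g\<^sub>-\<close>.\<close>
  have "x \<in> centralizer r" if x: "x \<in> carrier L" for x
  proof -
    have "x \<oplus> \<theta> x \<in> lo_plus L \<theta>" using x by (simp add: lo_plus_def theta_involutive a_comm)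
    moreover have "x \<ominus> \<theta> x \<in> lo_minus L \<theta>"
      using x by (simp add: lo_minus_def theta_involutive a_minus_def minus_add a_comm)
    ultimately have "(x \<oplus> \<theta> x) \<oplus> (x \<ominus> \<theta> x) \<in> centralizer r" using p m by blast
    also have "(x \<oplus> \<theta> x) \<oplus> (x \<ominus> \<theta> x) = x \<oplus> x"
      using x by (simp add: a_minus_def a_ac r_neg)
    finally show ?thesis using C.smult_closed[of "1/2" "x \<oplus> x"] half_double[OF x] by simp
  qed
  then show "r \<in> lie_center L" using c by (auto simp: lie_center_def centralizer_def)
qed

end

section \<open>The induced triple on the quotient by the radical\<close>

context extrinsic_triple_conditions
begin

abbreviation Dq where "Dq \<equiv> quotient_map L rad D"
abbreviation theta_q where "theta_q \<equiv> quotient_map L rad \<theta>"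

lemma D_image_radical: "D ` rad \<subseteq> rad"
  by (auto simp: D_radical)

lemma theta_image_radical: "\<theta> ` rad = rad"
proof
  show "\<theta> ` rad \<subseteq> rad" by (auto simp: theta_radical)
  show "rad \<subseteq> \<theta> ` rad"
  proof
    fix r assume "r \<in> rad"
    then have "r = \<theta> (\<theta> r)" "\<theta> r \<in> rad" by (simp_all add: theta_involutive radD theta_radical)
    then show "r \<in> \<theta> ` rad" by (rule image_eqI)
  qed
qed

lemma Dq_proj: "x \<in> carrier L \<Longrightarrow> Dq (radical.proj x) = radical.proj (D x)"
  by (rule radical.quotient_map_proj[OF D_linear D_image_radical])

lemma theta_q_proj: "x \<in> carrier L \<Longrightarrow> theta_q (radical.proj x) = radical.proj (\<theta> x)"
  by (rule radical.quotient_map_proj[OF theta_linear equalityD1[OF theta_image_radical]])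

lemma form_quotient:
  assumes x: "x \<in> carrier L" and y: "y \<in> carrier L"
  shows "quotient_form B (radical.proj x) (radical.proj y) = B x y"
proof -
  have "B x' y' = B x y" if "x' \<in> radical.proj x" "y' \<in> radical.proj y" for x' y'
  proof -
    obtain r s where rs: "r \<in> rad" "s \<in> rad" "x' = r \<oplus> x" "y' = s \<oplus> y"
      using \<open>x' \<in> radical.proj x\<close> \<open>y' \<in> radical.proj y\<close> by (auto simp: radical.mem_proj)
    have "B x s = 0" using B_sym[of x s] rs x by (simp add: radD)
    then show ?thesis using rs x y by (simp add: B_add_left B_add_right radD)
  qed
  then have "{B x' y' | x' y'. x' \<in> radical.proj x \<and> y' \<in> radical.proj y} = {B x y}"
    using radical.proj_self[OF x] radical.proj_self[OF y] by blast
  then show ?thesis by (simp add: quotient_form_def)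
qed

text \<open>Averaging any representative over \<open>\<theta>\<close> does not change its coset when that coset is
  \<open>\<theta>\<close>-fixed, and makes the representative fixed.\<close>

lemma lo_plus_quotient_lift:
  assumes "P \<in> lo_plus radical.Q theta_q"
  obtains x where "x \<in> lo_plus L \<theta>" "P = radical.proj x"
proof -
  obtain y where y: "y \<in> carrier L" "P = radical.proj y"
    using assms by (auto simp: lo_plus_def radical.carrier_quotient)
  have "radical.proj (\<theta> y) = radical.proj y"
    using assms y by (simp add: lo_plus_def theta_q_proj)
  then have "radical.proj ((1 / 2) \<odot> (y \<oplus> \<theta> y)) = radical.proj ((1 / 2) \<odot> (y \<oplus> y))"
    using y by (simp flip: radical.smult_quotient radical.add_quotient)
  then have "P = radical.proj ((1 / 2) \<odot> (y \<oplus> \<theta> y))"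
    using y by (simp add: half_double)
  moreover have "(1 / 2) \<odot> (y \<oplus> \<theta> y) \<in> lo_plus L \<theta>"
    using y by (simp add: lo_plus_def theta_involutive a_comm)
  ultimately show thesis using that by blast
qed

text \<open>If \<open>x\<close> is a \<open>\<theta>\<close>-fixed representative of a coset on which \<open>D\<^sup>2\<close> acts as \<open>-1\<close>, then
  \<open>-D (D x)\<close> represents the same coset and lies in \<open>g\<^sup>-\<close>, by \<open>D\<^sup>3 = -D\<close>.\<close>

lemma lo_plus_up_minus_quotient:
  "lo_plus_up_minus radical.Q Dq theta_q = radical.proj ` lo_plus_up_minus L D \<theta>"
proof
  show "radical.proj ` lo_plus_up_minus L D \<theta> \<subseteq> lo_plus_up_minus radical.Q Dq theta_q"
    by (auto simp: lo_plus_def up_minus_def radical.carrier_quotient theta_q_proj Dq_proj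
        radical.proj_minus)
  show "lo_plus_up_minus radical.Q Dq theta_q \<subseteq> radical.proj ` lo_plus_up_minus L D \<theta>"
  proof
    fix P assume P: "P \<in> lo_plus_up_minus radical.Q Dq theta_q"
    then obtain x where x: "x \<in> lo_plus L \<theta>" "P = radical.proj x"
      using lo_plus_quotient_lift by blast
    have c: "x \<in> carrier L" "\<theta> x = x" using x by (auto simp: lo_plus_def)
    have "radical.proj (D (D x)) = radical.proj (\<ominus> x)"
      using P x(2) c by (simp add: up_minus_def Dq_proj radical.proj_minus)
    then have "radical.proj (\<ominus> D (D x)) = radical.proj (\<ominus> (\<ominus> x))"
      using c by (simp only: radical.proj_minus[symmetric] D.T_im a_inv_closed)
    then have "P = radical.proj (\<ominus> D (D x))" using c x(2) by simp
    moreover have "\<ominus> D (D x) \<in> lo_plus_up_minus L D \<theta>"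
      using c by (simp add: lo_plus_def up_minus_def D_cubed theta_D)
    ultimately show "P \<in> radical.proj ` lo_plus_up_minus L D \<theta>" by (rule image_eqI)
  qed
qed

end

context weak_extrinsic_symmetric_triple
begin

text \<open>A representative \<open>x\<close> of a coset in the kernel of the induced map has \<open>D x\<close> in the radical,
  where \<open>D\<close> vanishes. Then \<open>D (D x) = 0\<close>, and \<open>-D x = D (D (D x)) = 0\<close>.\<close>

lemma lo_plus_up_plus_quotient:
  "lo_plus_up_plus radical.Q Dq theta_q = radical.proj ` lo_plus_up_plus L D \<theta>"
proof
  show "radical.proj ` lo_plus_up_plus L D \<theta> \<subseteq> lo_plus_up_plus radical.Q Dq theta_q"
    by (auto simp: lo_plus_def up_plus_def radical.carrier_quotient theta_q_proj Dq_proj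
        radical.zero_quotient radical.ideal_subset)
  show "lo_plus_up_plus radical.Q Dq theta_q \<subseteq> radical.proj ` lo_plus_up_plus L D \<theta>"
  proof
    fix P assume P: "P \<in> lo_plus_up_plus radical.Q Dq theta_q"
    then obtain x where x: "x \<in> lo_plus L \<theta>" "P = radical.proj x"
      using lo_plus_quotient_lift by blast
    have c: "x \<in> carrier L" using x by (auto simp: lo_plus_def)
    have "radical.proj (D x) = radical.proj \<zero>"
      using P x(2) c by (simp add: up_plus_def Dq_proj radical.proj_zero)
    then have "D x \<in> rad" using c by (simp add: radical.proj_eq_iff a_minus_def a_inv_zero)
    then have "\<ominus> D x = \<zero>"
      using D_on_radical[of "D x"] D_cubed[OF c] by (metis D.T0_is_0)
    then have "D x = \<zero>" using minus_swap[of "D x" \<zero>] c by (simp add: a_inv_zero)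
    then show "P \<in> radical.proj ` lo_plus_up_plus L D \<theta>"
      using x c by (auto simp: up_plus_def)
  qed
qed

lemma bracket_generates_quotient:
  "LinearCombinations.module.span real_field radical.Q {lie_bracket radical.Q u v | u v.
      u \<in> lo_plus_up_minus radical.Q Dq theta_q \<and> v \<in> lo_plus_up_minus radical.Q Dq theta_q}
    = lo_plus_up_plus radical.Q Dq theta_q"
proof -
  let ?S = "{lie_bracket L x y | x y. x \<in> lo_plus_up_minus L D \<theta> \<and> y \<in> lo_plus_up_minus L D \<theta>}"
  have c: "x \<in> carrier L" if "x \<in> lo_plus_up_minus L D \<theta>" for x
    using that by (auto simp: lo_plus_def)
  have "{lie_bracket radical.Q u v | u v.
      u \<in> lo_plus_up_minus radical.Q Dq theta_q \<and> v \<in> lo_plus_up_minus radical.Q Dq theta_q}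
    = radical.proj ` ?S" (is "?SQ = _")
  proof
    show "?SQ \<subseteq> radical.proj ` ?S"
    proof
      fix w assume "w \<in> ?SQ"
      then obtain x y where xy: "x \<in> lo_plus_up_minus L D \<theta>" "y \<in> lo_plus_up_minus L D \<theta>"
          "w = lie_bracket radical.Q (radical.proj x) (radical.proj y)"
        unfolding lo_plus_up_minus_quotient by blast
      then have "w = radical.proj (lie_bracket L x y)" using c by (simp only: radical.bracket_quotient)
      then show "w \<in> radical.proj ` ?S" using xy by blast
    qed
    show "radical.proj ` ?S \<subseteq> ?SQ"
    proof
      fix w assume "w \<in> radical.proj ` ?S"
      then obtain x y where xy: "x \<in> lo_plus_up_minus L D \<theta>" "y \<in> lo_plus_up_minus L D \<theta>"
          "w = radical.proj (lie_bracket L x y)" by blast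
      then have "w = lie_bracket radical.Q (radical.proj x) (radical.proj y)"
        using c by (simp only: radical.bracket_quotient)
      then show "w \<in> ?SQ" unfolding lo_plus_up_minus_quotient using xy by blast
    qed
  qed
  moreover have "?S \<subseteq> carrier L" using c bracket_closed by blast
  ultimately show ?thesis
    using linear_map.span_image[OF radical.proj_linear, of ?S] bracket_generates
    by (simp only: lo_plus_up_plus_quotient)
qed

lemma quotient_extrinsic_symmetric_triple:
  "extrinsic_symmetric_triple radical.Q (quotient_form B) Dq theta_q"
proof (intro extrinsic_symmetric_triple.intro extrinsic_triple_conditions.intro
    extrinsic_triple_conditions_axioms.intro extrinsic_symmetric_triple_axioms.intro)
  show "real_lie_algebra radical.Q" by (rule radical.quotient_lie_algebra)
  show "symmetric_bilinear_form radical.Q (quotient_form B)"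
    by (auto simp: symmetric_bilinear_form_def radical.carrier_quotient radical.add_quotient
        radical.smult_quotient form_quotient B_add_left B_smult_left intro: B_sym)
  show "ad_invariant radical.Q (quotient_form B)"
    by (auto simp: ad_invariant_def radical.carrier_quotient radical.bracket_quotient
        form_quotient bracket_closed B_bracket)
  show "lie_automorphism radical.Q theta_q"
    by (rule radical.quotient_map_automorphism[OF theta_automorphism theta_image_radical])
  show "lie_derivation radical.Q Dq"
    by (rule radical.quotient_map_derivation[OF D_derivation D_image_radical])
  show "nondegenerate_on radical.Q (carrier radical.Q) (quotient_form B)"
    by (auto simp: nondegenerate_on_def radical.carrier_quotient form_quotient
        radical.zero_quotient intro!: radical.proj_ideal) (auto simp: metric_radical_def)
  show "LinearCombinations.module.span real_field radical.Q {lie_bracket radical.Q u v | u v.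
      u \<in> lo_plus_up_minus radical.Q Dq theta_q \<and> v \<in> lo_plus_up_minus radical.Q Dq theta_q}
    = lo_plus_up_plus radical.Q Dq theta_q"
    by (rule bracket_generates_quotient)
qed (auto simp: radical.carrier_quotient theta_q_proj Dq_proj form_quotient radical.proj_minus
    theta_involutive theta_isometric D_antisymmetric D_cubed D_theta_anticommute)

end

theorem proposition6p1:
  fixes L :: "'a lie_alg"
    and B :: "'a \<Rightarrow> 'a \<Rightarrow> real"
    and D \<theta> :: "'a \<Rightarrow> 'a"
  assumes "weak_extrinsic_symmetric_triple L B D \<theta>"
  shows "metric_radical L B \<subseteq> lie_center L \<and>
    extrinsic_symmetric_triple
      (lie_quotient L (metric_radical L B))
      (quotient_form B)
      (quotient_map L (metric_radical L B) D)
      (quotient_map L (metric_radical L B) \<theta>)"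
proof -
  interpret weak_extrinsic_symmetric_triple L B D \<theta> by (rule assms)
  show ?thesis using radical_central quotient_extrinsic_symmetric_triple by blast
qed

end
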